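(* Let $f:\mathbb{R}^n\to\mathbb{R}$ be $\rho$-strongly convex and $L$-smooth ($\rho,L>0$), let $d\in\mathbb{R}^m$, and let $C\in\mathbb{R}^{m\times n}$ satisfy $\mathrm{c}_{\min}I_m\preceq CC^\top\preceq\mathrm{c}_{\max}I_m$ with $\mathrm{c}_{\min},\mathrm{c}_{\max}\in\mathbb{R}_{>0}$. For any $k_p^{in},k_i^{in}>0$, the SPPI dynamics $$\dot x=-\nabla f(x)-C^\top\mathrm{ReLU}\big(\xi+k_p^{in}(Cx-d)\big),\qquad\dot\xi=-k_i^{in}\xi+k_i^{in}\mathrm{ReLU}\big(\xi+k_p^{in}(Cx-d)\big)$$ on $\mathbb{R}^n\times\mathbb{R}^m$ are $c_{in}$-strongly infinitesimally contracting with respect to $\|\cdot\|_P$, where $$P=\begin{bmatrix}\gamma I_n&C^\top\\ C&\frac{\gamma}{k_i^{in}k_p^{in}}I_m\end{bmatrix}\succ0,\qquad c_{in}:=\frac{3k_i^{in}k_p^{in}\mathrm{c}_{\min}}{8\gamma},$$ and $\gamma>0$ is given by $$\gamma:=\max\left(k_i^{in},\ k_p^{in}\mathrm{c}_{\max},\ \frac23L+\frac{3k_i^{in}k_p^{in}\mathrm{c}_{\min}}{8\rho}+\frac23\,\frac{\chi(\chi+2L)}{\rho}\right)+\varepsilon,$$ with $\varepsilon>0$ and $$\chi:=k_p^{in}\mathrm{c}_{\max}+\frac{3k_i^{in}\mathrm{c}_{\min}}{4\mathrm{c}_{\max}}+k_i^{in}\sqrt{\frac{\mathrm{c}_{\m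ax}}{\mathrm{c}_{\min}}}.$$
   Context: $\mathrm{ReLU}(y)=\max(y,0)$ componentwise. $f$ is $\rho$-strongly convex if $x\mapsto f(x)-\frac\rho2\|x\|_2^2$ is convex, and $L$-smooth if it is differentiable with $L$-Lipschitz gradient. For $P\succ0$, $\|z\|_P=\sqrt{z^\top Pz}$, and the associated logarithmic norm is $\mu_P(S)=\min\{\beta\in\mathbb{R}: PS+S^\top P\preceq2\beta P\}$. A (locally Lipschitz) vector field $F$ is $c$-strongly infinitesimally contracting with respect to $\|\cdot\|_P$, with $c>0$, if $\mu_P(J_F(z))\le-c$ for all $z$ at which the Jacobian $J_F(z)$ exists (which is almost every $z$). *)

theory Defs
  imports "HOL-Analysis.Analysis"
begin

definition gradient :: "('a::euclidean_space \<Rightarrow> real) \<Rightarrow> 'a \<Rightarrow> 'a"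
  where "gradient f x = (THE D. GDERIV f x :> D)"

lemma gradient_eqI:
  assumes "GDERIV f x :> D"
  shows "gradient f x = D"
  unfolding gradient_def
proof (rule the_equality)
  fix D' assume "GDERIV f x :> D'"
  with assms have "(\<lambda>h. h \<bullet> D') = (\<lambda>h. h \<bullet> D)"
    unfolding gderiv_def by (rule has_derivative_unique[rotated])
  then have "h \<bullet> D' = h \<bullet> D" for h
    by (rule fun_cong)
  then show "D' = D"
    by (metis vector_eq_ldot)
qed (fact assms)

lemma differentiable_imp_GDERIV_gradient:
  fixes f :: "'a::euclidean_space \<Rightarrow> real"
  assumes "f differentiable (at x)"
  shows "GDERIV f x :> gradient f x"
proof -
  from assms obtain f' where f': "(f has_derivative f') (at x)"
    unfolding differentiable_def by blast
  define D where "D = (\<Sum>b\<in>Basis. f' b *\<^sub>R b)"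
  have "f' h = h \<bullet> D" for h
  proof -
    interpret linear f' using f' by (rule has_derivative_linear)
    have "f' h = f' (\<Sum>b\<in>Basis. (h \<bullet> b) *\<^sub>R b)"
      by (simp add: euclidean_representation)
    also have "\<dots> = (\<Sum>b\<in>Basis. (h \<bullet> b) * f' b)"
      by (simp add: sum scale)
    also have "\<dots> = h \<bullet> D"
      by (simp add: D_def inner_sum_right mult.commute)
    finally show ?thesis .
  qed
  then have "GDERIV f x :> D"
    using f' by (metis (no_types, lifting) ext gderiv_def)
  then show ?thesis
    by (simp add: gradient_eqI)
qed

definition strongly_convex :: "real \<Rightarrow> ('a::real_normed_vector \<Rightarrow> real) \<Rightarrow> bool"
  where "strongly_convex \<rho> f \<longleftrightarrow> convex_on UNIV (\<lambda>x. f x - \<rho> / 2 * (norm x)\<^sup>2)"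

definition smooth_fun :: "real \<Rightarrow> ('a::euclidean_space \<Rightarrow> real) \<Rightarrow> bool"
  where "smooth_fun L f \<longleftrightarrow>
    (\<forall>x. f differentiable (at x)) \<and> L-lipschitz_on UNIV (gradient f)"

definition pos_semidef :: "real^'k^'k \<Rightarrow> bool"
  where "pos_semidef A \<longleftrightarrow> transpose A = A \<and> (\<forall>z. 0 \<le> z \<bullet> (A *v z))"

definition pos_def :: "real^'k^'k \<Rightarrow> bool"
  where "pos_def A \<longleftrightarrow> transpose A = A \<and> (\<forall>z. z \<noteq> 0 \<longrightarrow> 0 < z \<bullet> (A *v z))"

definition loewner_le :: "real^'k^'k \<Rightarrow> real^'k^'k \<Rightarrow> bool"  (infix "\<preceq>\<^sub>L" 50)
  where "A \<preceq>\<^sub>L B \<longleftrightarrow> pos_semidef (B - A)"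

(* LEAST is a genuine minimum for positive definite P, the only case in which log_norm is used. *)
definition log_norm :: "real^'k^'k \<Rightarrow> real^'k^'k \<Rightarrow> real"
  where "log_norm P S = (LEAST \<beta>. P ** S + transpose S ** P \<preceq>\<^sub>L (2 * \<beta>) *\<^sub>R P)"

(* local_lipschitz is stated for time-dependent fields; F is regarded as constant in time. *)
definition strongly_infinitesimally_contracting ::
    "real \<Rightarrow> real^'k^'k \<Rightarrow> (real^'k \<Rightarrow> real^'k) \<Rightarrow> bool"
  where "strongly_infinitesimally_contracting c P F \<longleftrightarrow>
    0 < c \<and> pos_def P \<and> local_lipschitz (UNIV :: real set) UNIV (\<lambda>_. F) \<and>
    (\<forall>z. F differentiable (at z) \<longrightarrow> log_norm P (jacobian F (at z)) \<le> - c)"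

definition relu :: "real^'m \<Rightarrow> real^'m"
  where "relu y = (\<chi> j. max (y $ j) 0)"

(* R^n x R^m is represented by vectors indexed by the sum type 'n + 'm. *)
definition join_vec :: "real^'n \<Rightarrow> real^'m \<Rightarrow> real^('n::finite + 'm::finite)"
  where "join_vec x \<xi> = (\<chi> k. case k of Inl i \<Rightarrow> x $ i | Inr j \<Rightarrow> \<xi> $ j)"

definition proj_left :: "real^('n::finite + 'm::finite) \<Rightarrow> real^'n"
  where "proj_left z = (\<chi> i. z $ Inl i)"

definition proj_right :: "real^('n::finite + 'm::finite) \<Rightarrow> real^'m"
  where "proj_right z = (\<chi> j. z $ Inr j)"

definition block_mat ::
    "real^'n^'n \<Rightarrow> real^'m^'n \<Rightarrow> real^'n^'m \<Rightarrow> real^'m^'m \<Rightarrow> real^('n::finite + 'm::finite)^('n + 'm)"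
  where "block_mat A B C D = (\<chi> r s.
    case r of
      Inl i \<Rightarrow> (case s of Inl i' \<Rightarrow> A $ i $ i' | Inr j' \<Rightarrow> B $ i $ j')
    | Inr j \<Rightarrow> (case s of Inl i' \<Rightarrow> C $ j $ i' | Inr j' \<Rightarrow> D $ j $ j'))"

definition SPPI_field ::
    "(real^'n \<Rightarrow> real) \<Rightarrow> real^'n^'m \<Rightarrow> real^'m \<Rightarrow> real \<Rightarrow> real \<Rightarrow> real^('n::finite + 'm::finite) \<Rightarrow> real^('n + 'm)"
  where "SPPI_field f C d k\<^sub>p k\<^sub>i z =
    (let x = proj_left z; \<xi> = proj_right z; u = relu (\<xi> + k\<^sub>p *\<^sub>R (C *v x - d))
     in join_vec (- gradient f x - transpose C *v u) (- (k\<^sub>i *\<^sub>R \<xi>) + k\<^sub>i *\<^sub>R u))"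

end

theory Submission
  imports Defs
begin

text \<open>
  The contraction estimate is proved for increments rather than for Jacobians, so neither the
  symmetry of the Hessian nor the points of nondifferentiability of ReLU matter. For an increment
  \<open>(x, \<xi>)\<close> of the state let \<open>g\<close> and \<open>u\<close> be the increments of the gradient and of the ReLU term, and put
  \<open>v = \<xi> - u\<close>, \<open>p = C\<^sup>T \<xi>\<close>, \<open>q = C\<^sup>T v\<close>. Firm nonexpansiveness of ReLU gives
  \<open>u \<bullet> (\<xi> + k\<^sub>p C x) \<ge> |u|\<^sup>2\<close>, and together with \<open>\<gamma> \<ge> k\<^sub>p c\<^sub>m\<^sub>a\<^sub>x\<close> this bounds the \<open>P\<close>-inner product of the
  increments of state and field by minus \<open>\<gamma> x \<bullet> g + |q|\<^sup>2 + p \<bullet> g + |p|\<^sup>2 - p \<bullet> q + k\<^sub>i x \<bullet> q\<close>, a form in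
  \<open>x, g, p, q\<close> only. Completing squares reduces its lower bound to strong monotonicity and
  cocoercivity of the gradient.
\<close>


section \<open>Gradient inequalities from strong convexity and smoothness\<close>

text \<open>The convex function \<open>h\<close> lies above its tangent along the line through
  \<open>x\<close> and \<open>y\<close>. Expanding \<open>(norm y)\<^sup>2\<close> around
  \<open>x\<close> then leaves exactly the quadratic term in \<open>y - x\<close>.\<close>

lemma strongly_convex_tangent_bound:
  fixes f :: "'a::euclidean_space \<Rightarrow> real"
  assumes "strongly_convex \<rho> f" and "GDERIV f x :> D"
  shows "f x + D \<bullet> (y - x) + \<rho> / 2 * (norm (y - x))\<^sup>2 \<le> f y"
proof -
  define h where "h = (\<lambda>x. f x - \<rho> / 2 * (norm x)\<^sup>2)"
  define v where "v = y - x"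
  define \<phi> where "\<phi> = (\<lambda>t::real. h (x + t *\<^sub>R v))"
  have h: "convex_on UNIV h"
    using assms(1) by (simp add: strongly_convex_def h_def)
  have "convex_on UNIV \<phi>"
  proof (rule convex_onI)
    fix t a b :: real assume t: "0 < t" "t < 1"
    have "x + ((1 - t) *\<^sub>R a + t *\<^sub>R b) *\<^sub>R v = (1 - t) *\<^sub>R (x + a *\<^sub>R v) + t *\<^sub>R (x + b *\<^sub>R v)"
      by (simp add: algebra_simps)
    then show "\<phi> ((1 - t) *\<^sub>R a + t *\<^sub>R b) \<le> (1 - t) * \<phi> a + t * \<phi> b"
      using convex_onD[OF h, of t "x + a *\<^sub>R v" "x + b *\<^sub>R v"] t by (simp add: \<phi>_def)
  qed simp
  moreover have "(\<phi> has_real_derivative v \<bullet> D - \<rho> * (x \<bullet> v)) (at 0)"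
  proof -
    have f': "(f has_derivative (\<lambda>h. h \<bullet> D)) (at x)"
      using assms(2) by (simp add: gderiv_def)
    have "((\<lambda>t::real. f (x + t *\<^sub>R v)) has_derivative (\<lambda>t. (t *\<^sub>R v) \<bullet> D)) (at 0)"
      by (rule has_derivative_compose[where f = "\<lambda>t. x + t *\<^sub>R v" and g = f])
        (auto intro!: derivative_eq_intros simp: f')
    then have "((\<lambda>t::real. f (x + t *\<^sub>R v)) has_real_derivative v \<bullet> D) (at 0)"
      by (simp add: has_field_derivative_def mult.commute[of _ "v \<bullet> D"])
    moreover have "((\<lambda>t::real. \<rho> / 2 * (norm (x + t *\<^sub>R v))\<^sup>2) has_real_derivative \<rho> * (x \<bullet> v)) (at 0)"
      unfolding power2_norm_eq_inner inner_add inner_scaleR_left inner_scaleR_right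
      by (auto intro!: derivative_eq_intros simp: inner_commute algebra_simps)
    ultimately show ?thesis
      unfolding \<phi>_def h_def by (rule DERIV_diff)
  qed
  ultimately have "\<phi> 1 - \<phi> 0 \<ge> (v \<bullet> D - \<rho> * (x \<bullet> v)) * (1 - 0)"
    by (intro convex_on_imp_above_tangent) auto
  then have "v \<bullet> D - \<rho> * (x \<bullet> v) \<le> h y - h x"
    by (simp add: \<phi>_def v_def)
  moreover have "(norm y)\<^sup>2 = (norm x)\<^sup>2 + 2 * (x \<bullet> v) + (norm v)\<^sup>2"
    unfolding v_def power2_norm_eq_inner by (simp add: inner_diff inner_commute)
  then have "\<rho> / 2 * (norm y)\<^sup>2 = \<rho> / 2 * (norm x)\<^sup>2 + \<rho> * (x \<bullet> v) + \<rho> / 2 * (norm v)\<^sup>2"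
    by (simp only: distrib_left)
  ultimately show ?thesis
    unfolding h_def v_def[symmetric] inner_commute[of D] by linarith
qed

lemma smooth_fun_GDERIV:
  assumes "smooth_fun L f"
  shows "GDERIV f x :> gradient f x"
  using assms by (simp add: smooth_fun_def differentiable_imp_GDERIV_gradient)

lemma smooth_fun_norm_le:
  assumes "smooth_fun L f"
  shows "norm (gradient f x - gradient f y) \<le> L * norm (x - y)"
  using assms lipschitz_onD[of L UNIV "gradient f" x y] by (simp add: smooth_fun_def dist_norm)

text \<open>Here \<open>\<phi>\<close> is, up to a constant, \<open>f\<close> on the segment minus
  its quadratic upper model. Cauchy-Schwarz and the Lipschitz gradient make its derivative
  nonpositive, so no integration is involved.\<close>

lemma smooth_fun_descent:
  fixes f :: "'a::euclidean_space \<Rightarrow> real"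
  assumes "smooth_fun L f"
  shows "f y \<le> f x + gradient f x \<bullet> (y - x) + L / 2 * (norm (y - x))\<^sup>2"
proof -
  define v where "v = y - x"
  define \<phi> where "\<phi> = (\<lambda>t::real. f (x + t *\<^sub>R v) - t * (gradient f x \<bullet> v) - L / 2 * t\<^sup>2 * (norm v)\<^sup>2)"
  have "\<phi> 1 \<le> \<phi> 0"
  proof (rule DERIV_nonpos_imp_nonincreasing[of 0 1 \<phi>])
    fix t :: real assume t: "0 \<le> t" "t \<le> 1"
    have f': "(f has_derivative (\<lambda>h. h \<bullet> gradient f (x + t *\<^sub>R v))) (at (x + t *\<^sub>R v))"
      using smooth_fun_GDERIV[OF assms] by (simp add: gderiv_def)
    have "((\<lambda>t::real. f (x + t *\<^sub>R v)) has_derivative (\<lambda>s. (s *\<^sub>R v) \<bullet> gradient f (x + t *\<^sub>R v))) (at t)"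
      by (rule has_derivative_compose[where f = "\<lambda>t. x + t *\<^sub>R v" and g = f])
        (auto intro!: derivative_eq_intros simp: f')
    then have "((\<lambda>t::real. f (x + t *\<^sub>R v)) has_real_derivative v \<bullet> gradient f (x + t *\<^sub>R v)) (at t)"
      by (simp add: has_field_derivative_def mult.commute[of _ "v \<bullet> _"])
    then have "(\<phi> has_real_derivative
        v \<bullet> gradient f (x + t *\<^sub>R v) - gradient f x \<bullet> v - L * t * (norm v)\<^sup>2) (at t)"
      unfolding \<phi>_def by (auto intro!: derivative_eq_intros)
    moreover have "(gradient f (x + t *\<^sub>R v) - gradient f x) \<bullet> v \<le> L * t * (norm v)\<^sup>2"
    proof -
      have "(gradient f (x + t *\<^sub>R v) - gradient f x) \<bullet> v
          \<le> norm (gradient f (x + t *\<^sub>R v) - gradient f x) * norm v"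
        by (rule norm_cauchy_schwarz)
      also have "\<dots> \<le> (L * norm ((x + t *\<^sub>R v) - x)) * norm v"
        by (intro mult_right_mono smooth_fun_norm_le[OF assms]) simp
      finally show ?thesis using t by (simp add: power2_eq_square mult.assoc)
    qed
    ultimately show "\<exists>y. (\<phi> has_real_derivative y) (at t) \<and> y \<le> 0"
      by (intro exI conjI) (auto simp: inner_diff inner_commute)
  qed simp
  then show ?thesis by (simp add: \<phi>_def v_def)
qed

text \<open>Add the tangent bounds based at \<open>x\<close> and at \<open>y\<close>; the function
  values cancel.\<close>

lemma gradient_strongly_monotone:
  fixes f :: "'a::euclidean_space \<Rightarrow> real"
  assumes "strongly_convex \<rho> f" and "smooth_fun L f"
  shows "\<rho> * (norm (x - y))\<^sup>2 \<le> (x - y) \<bullet> (gradient f x - gradient f y)"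
  using strongly_convex_tangent_bound[OF assms(1) smooth_fun_GDERIV[OF assms(2)], of x y]
    strongly_convex_tangent_bound[OF assms(1) smooth_fun_GDERIV[OF assms(2)], of y x]
  by (simp add: inner_diff inner_commute norm_minus_commute algebra_simps)

text \<open>The Baillon--Haddad theorem: the tilted function \<open>f - gradient f x\<close> is minimal at \<open>x\<close>, and a
  gradient step of length \<open>1 / L\<close> from \<open>y\<close> decreases it by the square of its gradient over \<open>2 * L\<close>.\<close>

lemma gradient_cocoercive:
  fixes f :: "'a::euclidean_space \<Rightarrow> real"
  assumes "strongly_convex \<rho> f" and "0 \<le> \<rho>" and "smooth_fun L f" and "0 < L"
  shows "(norm (gradient f x - gradient f y))\<^sup>2 \<le> L * ((x - y) \<bullet> (gradient f x - gradient f y))"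
proof -
  have half: "f x + gradient f x \<bullet> (y - x) + (norm (gradient f y - gradient f x))\<^sup>2 / (2 * L) \<le> f y" for x y
  proof -
    define w where "w = gradient f y - gradient f x"
    define z where "z = y - (1 / L) *\<^sub>R w"
    have "f x + gradient f x \<bullet> (z - x) + \<rho> / 2 * (norm (z - x))\<^sup>2 \<le> f z"
      by (rule strongly_convex_tangent_bound[OF assms(1) smooth_fun_GDERIV[OF assms(3)]])
    moreover have "0 \<le> \<rho> / 2 * (norm (z - x))\<^sup>2"
      using assms(2) by simp
    ultimately have "f x + gradient f x \<bullet> (z - x) \<le> f z"
      by linarith
    also have "f z \<le> f y + gradient f y \<bullet> (z - y) + L / 2 * (norm (z - y))\<^sup>2"
      by (rule smooth_fun_descent[OF assms(3)])
    finally have "f x + gradient f x \<bullet> (y - x) \<le> f y + w \<bullet> (z - y) + L / 2 * (norm (z - y))\<^sup>2"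
      by (simp add: w_def inner_diff)
    \<comment> \<open>The linear gain is twice the quadratic loss computed next, so the net decrease
      is \<open>(norm w)\<^sup>2 / (2 * L)\<close>.\<close>
    moreover have "w \<bullet> (z - y) = - 2 * ((norm w)\<^sup>2 / (2 * L))"
      unfolding z_def power2_norm_eq_inner by simp
    moreover have "norm (z - y) = norm w / L"
      using assms(4) by (simp add: z_def)
    then have "L / 2 * (norm (z - y))\<^sup>2 = (norm w)\<^sup>2 / (2 * L)"
      using assms(4) by (simp add: power2_eq_square)
    ultimately show ?thesis
      unfolding w_def[symmetric] by linarith
  qed
  \<comment> \<open>Using \<open>half\<close> in both orders cancels the function values and doubles
    the constant to \<open>1 / L\<close>.\<close>
  have "(norm (gradient f y - gradient f x))\<^sup>2 / (2 * L) + (norm (gradient f x - gradient f y))\<^sup>2 / (2 * L)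
      \<le> (x - y) \<bullet> (gradient f x - gradient f y)"
    using half[of x y] half[of y x] by (simp only: inner_diff inner_commute)
  then have "(norm (gradient f x - gradient f y))\<^sup>2 / L \<le> (x - y) \<bullet> (gradient f x - gradient f y)"
    by (simp add: norm_minus_commute[of "gradient f y"])
  then show ?thesis
    using assms(4) by (simp add: divide_le_eq mult.commute)
qed

section \<open>Increments of ReLU\<close>

text \<open>The inequality holds coordinatewise, because the scalar map \<open>max s 0\<close> is
  nondecreasing and 1-Lipschitz; the proof splits on signs.\<close>

lemma relu_firmly_nonexpansive:
  "(norm (relu y - relu y'))\<^sup>2 \<le> (y - y') \<bullet> (relu y - relu y')"
  unfolding power2_norm_eq_inner inner_vec_def
  by (rule sum_mono)
    (auto simp: relu_def max_def algebra_simps mult_mono mult_nonneg_nonpos mult_nonpos_nonneg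
      mult_nonpos_nonpos)

lemma norm_relu_diff_le: "norm (relu y - relu y') \<le> norm (y - y')"
proof (cases "relu y = relu y'")
  case False
  have "norm (relu y - relu y') * norm (relu y - relu y') \<le> norm (y - y') * norm (relu y - relu y')"
    using relu_firmly_nonexpansive[of y y'] norm_cauchy_schwarz[of "y - y'" "relu y - relu y'"]
    by (simp add: power2_eq_square)
  then show ?thesis using False by simp
qed simp

section \<open>Block coordinates, transposes and Loewner bounds\<close>

lemma proj_left_join_vec [simp]: "proj_left (join_vec x \<xi>) = x"
  and proj_right_join_vec [simp]: "proj_right (join_vec x \<xi>) = \<xi>"
  and join_vec_proj [simp]: "join_vec (proj_left z) (proj_right z) = z"
  by (auto simp: proj_left_def proj_right_def join_vec_def vec_eq_iff split: sum.split)

lemma inner_join_vec: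
  "join_vec x \<xi> \<bullet> z = x \<bullet> proj_left z + \<xi> \<bullet> proj_right z"
  by (simp add: inner_vec_def join_vec_def proj_left_def proj_right_def
      UNIV_Plus_UNIV[symmetric] sum.Plus del: UNIV_Plus_UNIV)

lemma block_mat_mult_join_vec:
  "block_mat A B C D *v join_vec x \<xi> = join_vec (A *v x + B *v \<xi>) (C *v x + D *v \<xi>)"
  by (auto simp: vec_eq_iff matrix_vector_mult_def block_mat_def join_vec_def
      UNIV_Plus_UNIV[symmetric] sum.Plus simp del: UNIV_Plus_UNIV split: sum.split)

lemma transpose_block_mat:
  "transpose (block_mat A B C D) = block_mat (transpose A) (transpose C) (transpose B) (transpose D)"
  by (auto simp: vec_eq_iff transpose_def block_mat_def split: sum.split)

lemma linear_proj_left: "linear proj_left" and linear_proj_right: "linear proj_right"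
  by (auto intro!: linearI simp: proj_left_def proj_right_def vec_eq_iff)

lemma linear_join_vec: "linear (\<lambda>p. join_vec (fst p) (snd p))"
  by (auto intro!: linearI simp: join_vec_def vec_eq_iff split: sum.split)

lemma inner_transpose_mult: "x \<bullet> (transpose C *v \<xi>) = (C *v x) \<bullet> (\<xi> :: real^'m)"
  by (metis dot_lmul_matrix inner_commute transpose_matrix_vector)

lemma norm_transpose_mult:
  fixes C :: "real^'n^'m"
  shows "(norm (transpose C *v \<xi>))\<^sup>2 = \<xi> \<bullet> ((C ** transpose C) *v \<xi>)"
  unfolding power2_norm_eq_inner inner_transpose_mult matrix_vector_mul_assoc by (rule inner_commute)

lemma inner_scaleR_mat_1_mult: "\<xi> \<bullet> ((c *\<^sub>R mat 1) *v \<xi>) = c * (norm (\<xi> :: real^'m))\<^sup>2"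
  unfolding power2_norm_eq_inner scaleR_matrix_vector_assoc[symmetric] by simp

lemma loewner_le_inner: "A \<preceq>\<^sub>L B \<Longrightarrow> \<xi> \<bullet> (A *v \<xi>) \<le> \<xi> \<bullet> (B *v \<xi>)"
  by (simp add: loewner_le_def pos_semidef_def matrix_vector_mult_diff_rdistrib inner_diff_right)

lemma norm_transpose_mult_le:
  fixes C :: "real^'n^'m"
  assumes "C ** transpose C \<preceq>\<^sub>L c *\<^sub>R mat 1"
  shows "(norm (transpose C *v \<xi>))\<^sup>2 \<le> c * (norm \<xi>)\<^sup>2"
  using loewner_le_inner[OF assms, of \<xi>] unfolding norm_transpose_mult inner_scaleR_mat_1_mult .

lemma norm_transpose_mult_ge:
  fixes C :: "real^'n^'m"
  assumes "c *\<^sub>R mat 1 \<preceq>\<^sub>L C ** transpose C"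
  shows "c * (norm \<xi>)\<^sup>2 \<le> (norm (transpose C *v \<xi>))\<^sup>2"
  using loewner_le_inner[OF assms, of \<xi>] unfolding norm_transpose_mult inner_scaleR_mat_1_mult .

section \<open>The quadratic form in \<open>x\<close>, \<open>g\<close>, \<open>p\<close> and
  \<open>q\<close>\<close>

text \<open>Complete the square first in \<open>q\<close>, then in \<open>p\<close>.\<close>

lemma contraction_form_nonneg:
  fixes x g p q :: "'a::real_inner"
  assumes "0 < \<rho>" and mono: "\<rho> * (norm x)\<^sup>2 \<le> x \<bullet> g" and coco: "(norm g)\<^sup>2 \<le> L * (x \<bullet> g)"
    and lip: "norm g \<le> L * norm x" and "0 \<le> L"
    and \<gamma>: "2 / 3 * L + a / \<rho> + 2 / 3 * (X * (X + 2 * L) / \<rho>) \<le> \<gamma>" and "0 \<le> a" and "0 \<le> X"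
    and s: "\<bar>k / 2 - 2 * c\<bar> \<le> X" "(k / 2 - 2 * c)\<^sup>2 + 3 / 8 * k\<^sup>2 \<le> X\<^sup>2"
  shows "a * (norm x)\<^sup>2 + 2 * c * (x \<bullet> p) + 3 / 8 * (norm p)\<^sup>2
    \<le> \<gamma> * (x \<bullet> g) + (norm q)\<^sup>2 + p \<bullet> g + (norm p)\<^sup>2 - p \<bullet> q + k * (x \<bullet> q)"
proof -
  \<comment> \<open>The square in \<open>q\<close> contributes
    \<open>k / 2 * (x \<bullet> p)\<close> and the left-hand side
    \<open>- 2 * c * (x \<bullet> p)\<close>, so \<open>p\<close> ends up paired with
    \<open>g + s *\<^sub>R x\<close>.\<close>
  define s where "s = k / 2 - 2 * c"
  have xg0: "0 \<le> x \<bullet> g"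
    using mono \<open>0 < \<rho>\<close> by (meson order_trans mult_nonneg_nonneg less_imp_le zero_le_power2)
  have "x \<bullet> g \<le> norm x * norm g"
    by (rule norm_cauchy_schwarz)
  also have "\<dots> \<le> norm x * (L * norm x)"
    by (rule mult_left_mono[OF lip]) simp
  finally have xgL: "x \<bullet> g \<le> L * (norm x)\<^sup>2"
    by (simp add: power2_eq_square mult.left_commute)
  \<comment> \<open>The hypothesis on \<open>\<gamma>\<close> reads
    \<open>M / \<rho> + 2 / 3 * L \<le> \<gamma>\<close>. Strong monotonicity turns the first
    summand into \<open>M * (norm x)\<^sup>2\<close>; the second is kept for cocoercivity.\<close>
  define M where "M = a + 2 / 3 * (X * (X + 2 * L))"
  have M0: "0 \<le> M" using assms by (simp add: M_def)
  have "M * (norm x)\<^sup>2 = M / \<rho> * (\<rho> * (norm x)\<^sup>2)"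
    using \<open>0 < \<rho>\<close> by simp
  also have "\<dots> \<le> M / \<rho> * (x \<bullet> g)"
    using M0 \<open>0 < \<rho>\<close> by (intro mult_left_mono[OF mono]) simp
  also have "\<dots> \<le> (\<gamma> - 2 / 3 * L) * (x \<bullet> g)"
    using \<gamma> by (intro mult_right_mono xg0) (simp add: M_def add_divide_distrib)
  finally have 1: "M * (norm x)\<^sup>2 + 2 / 3 * (L * (x \<bullet> g)) \<le> \<gamma> * (x \<bullet> g)"
    by (simp add: algebra_simps)
  have "s * (x \<bullet> g) \<le> \<bar>s\<bar> * (x \<bullet> g)"
    by (rule mult_right_mono[OF _ xg0]) simp
  also have "\<dots> \<le> X * (L * (norm x)\<^sup>2)"
    by (rule mult_mono[OF s(1)[folded s_def] xgL \<open>0 \<le> X\<close> xg0])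
  finally have 2: "s * (x \<bullet> g) \<le> X * L * (norm x)\<^sup>2" by simp
  \<comment> \<open>The weight 3/8 is fixed by 2/3 * 3/8 = 1/4, the coefficient of
    \<open>k\<^sup>2 * (norm x)\<^sup>2\<close> left over by the square in \<open>q\<close>.\<close>
  have 3: "(s\<^sup>2 + 3 / 8 * k\<^sup>2) * (norm x)\<^sup>2 \<le> X\<^sup>2 * (norm x)\<^sup>2"
    by (rule mult_right_mono[OF s(2)[folded s_def]]) simp
  \<comment> \<open>This is the remainder after both squares. Expanding
    \<open>g + s *\<^sub>R x\<close> gives one term for cocoercivity, one for fact 2 and one for
    fact 3.\<close>
  have core: "(a + k\<^sup>2 / 4) * (norm x)\<^sup>2 + 2 / 3 * (norm (g + s *\<^sub>R x))\<^sup>2 \<le> \<gamma> * (x \<bullet> g)"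
  proof -
    have "(norm (g + s *\<^sub>R x))\<^sup>2 = (norm g)\<^sup>2 + 2 * (s * (x \<bullet> g)) + s\<^sup>2 * (norm x)\<^sup>2"
      unfolding power2_norm_eq_inner
      by (simp add: inner_add inner_commute[of g x] power2_eq_square[of s] distrib_left)
    moreover have "M * (norm x)\<^sup>2 = a * (norm x)\<^sup>2 + 2 / 3 * (X\<^sup>2 * (norm x)\<^sup>2) + 4 / 3 * (X * L * (norm x)\<^sup>2)"
      by (simp add: M_def power2_eq_square[of X] distrib_left distrib_right mult.assoc)
    moreover have "(s\<^sup>2 + 3 / 8 * k\<^sup>2) * (norm x)\<^sup>2 = s\<^sup>2 * (norm x)\<^sup>2 + 3 / 8 * (k\<^sup>2 * (norm x)\<^sup>2)"
      and "(a + k\<^sup>2 / 4) * (norm x)\<^sup>2 = a * (norm x)\<^sup>2 + 1 / 4 * (k\<^sup>2 * (norm x)\<^sup>2)"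
      by (simp_all add: distrib_right)
    ultimately show ?thesis
      using 1 2 3 coco by linarith
  qed
  \<comment> \<open>After the square in \<open>q\<close>, the coefficient of
    \<open>(norm p)\<^sup>2\<close> is 1 - 1/4 - 3/8 = 3/8. Completing that square costs 1 / (4 *
    3/8) = 2/3.\<close>
  have "\<gamma> * (x \<bullet> g) + (norm q)\<^sup>2 + p \<bullet> g + (norm p)\<^sup>2 - p \<bullet> q + k * (x \<bullet> q)
      - (a * (norm x)\<^sup>2 + 2 * c * (x \<bullet> p) + 3 / 8 * (norm p)\<^sup>2)
    = (norm (q - (1/2) *\<^sub>R (p - k *\<^sub>R x)))\<^sup>2 + 3 / 8 * (norm (p + (4 / 3) *\<^sub>R (g + s *\<^sub>R x)))\<^sup>2
      + (\<gamma> * (x \<bullet> g) - ((a + k\<^sup>2 / 4) * (norm x)\<^sup>2 + 2 / 3 * (norm (g + s *\<^sub>R x))\<^sup>2))"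
    unfolding power2_norm_eq_inner s_def
    by (simp add: inner_add inner_diff inner_commute power2_eq_square field_simps)
  moreover have "0 \<le> (norm (q - (1/2) *\<^sub>R (p - k *\<^sub>R x)))\<^sup>2" 
      "0 \<le> (norm (p + (4 / 3) *\<^sub>R (g + s *\<^sub>R x)))\<^sup>2" by simp_all
  ultimately show ?thesis using core by linarith
qed

section \<open>Logarithmic norms and one-sided Lipschitz bounds\<close>

text \<open>\<open>LEAST\<close> is informative only if the minimum is attained. The admissible
  values are the upper bounds of the generalized Rayleigh quotients \<open>r h\<close>, so their
  infimum is again admissible.\<close>

lemma log_norm_le:
  assumes P: "pos_def P" and le: "\<And>h. h \<bullet> (P *v (S *v h)) \<le> b * (h \<bullet> (P *v h))"
  shows "log_norm P S \<le> b"
proof -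
  define Q where "Q = (\<lambda>\<beta>. P ** S + transpose S ** P \<preceq>\<^sub>L (2 * \<beta>) *\<^sub>R P)"
  have sym: "transpose P = P" using P by (simp add: pos_def_def)
  have Q_iff: "Q \<beta> \<longleftrightarrow> (\<forall>h. h \<bullet> (P *v (S *v h)) \<le> \<beta> * (h \<bullet> (P *v h)))" for \<beta>
  proof -
    have "h \<bullet> (transpose S *v (P *v h)) = h \<bullet> (P *v (S *v h))" for h
      by (metis sym inner_transpose_mult inner_commute)
    then have form: "h \<bullet> (((2 * \<beta>) *\<^sub>R P - (P ** S + transpose S ** P)) *v h)
        = 2 * (\<beta> * (h \<bullet> (P *v h)) - h \<bullet> (P *v (S *v h)))" for h
      by (simp add: matrix_vector_mult_diff_rdistrib matrix_vector_mult_add_rdistrib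
          scaleR_matrix_vector_assoc[symmetric] matrix_vector_mul_assoc[symmetric] inner_diff_right inner_add_right)
    have "transpose ((2 * \<beta>) *\<^sub>R P - (P ** S + transpose S ** P))
        = (2 * \<beta>) *\<^sub>R transpose P - (transpose (P ** S) + transpose (transpose S ** P))"
      by (simp add: transpose_def vec_eq_iff)
    then have "transpose ((2 * \<beta>) *\<^sub>R P - (P ** S + transpose S ** P)) = (2 * \<beta>) *\<^sub>R P - (P ** S + transpose S ** P)"
      by (simp add: matrix_transpose_mul sym add.commute)
    then show ?thesis
      by (simp add: Q_def loewner_le_def pos_semidef_def form)
  qed
  define r where "r = (\<lambda>h. h \<bullet> (P *v (S *v h)) / (h \<bullet> (P *v h)))"
  have Q_r: "Q \<beta> \<longleftrightarrow> (\<forall>h. h \<noteq> 0 \<longrightarrow> r h \<le> \<beta>)" for \<beta>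
  proof -
    have "h \<bullet> (P *v (S *v h)) \<le> \<beta> * (h \<bullet> (P *v h)) \<longleftrightarrow> r h \<le> \<beta>" if "h \<noteq> 0" for h
      using P that by (simp add: pos_def_def r_def divide_le_eq)
    then show ?thesis
      unfolding Q_iff by (metis inner_zero_left mult_zero_right order_refl)
  qed
  have Qb: "Q b" using le by (simp add: Q_iff)
  obtain h0 :: "real^'a" where "h0 \<noteq> 0"
    by (metis axis_eq_0_iff zero_neq_one)
  then have bdd: "bdd_below {\<beta>. Q \<beta>}"
    by (intro bdd_belowI[of _ "r h0"]) (simp add: Q_r)
  have "Q (Inf {\<beta>. Q \<beta>})"
    unfolding Q_r by (intro allI impI cInf_greatest) (use Qb in \<open>auto simp: Q_r\<close>)
  then have "(LEAST \<beta>. Q \<beta>) = Inf {\<beta>. Q \<beta>}"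
    by (rule Least_equality) (simp add: cInf_lower bdd)
  also have "\<dots> \<le> b" by (rule cInf_lower) (simp_all add: Qb bdd)
  finally show ?thesis by (simp add: log_norm_def Q_def)
qed

text \<open>A one-sided Lipschitz bound passes to the Jacobian by taking difference quotients.\<close>

lemma strongly_infinitesimally_contractingI:
  fixes F :: "real^'k \<Rightarrow> real^'k"
  assumes "0 < c" and P: "pos_def P" and lip: "K-lipschitz_on UNIV F"
    and osl: "\<And>w z. (w - z) \<bullet> (P *v (F w - F z)) \<le> - c * ((w - z) \<bullet> (P *v (w - z)))"
  shows "strongly_infinitesimally_contracting c P F"
proof -
  have "local_lipschitz (UNIV :: real set) UNIV (\<lambda>_. F)"
    by (rule local_lipschitzI) (use lip lipschitz_on_subset[OF lip] zero_less_one in blast)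
  moreover have "log_norm P (jacobian F (at z)) \<le> - c" if F: "F differentiable (at z)" for z
  proof (rule log_norm_le[OF P])
    fix h
    define J where "J = jacobian F (at z)"
    have J: "(F has_derivative (\<lambda>h. J *v h)) (at z)"
      using F by (simp add: J_def jacobian_works)
    have "((\<lambda>t::real. F (z + t *\<^sub>R h)) has_derivative (\<lambda>t. J *v (t *\<^sub>R h))) (at 0)"
      by (rule has_derivative_compose[where f = "\<lambda>t. z + t *\<^sub>R h" and g = F])
        (auto intro!: derivative_eq_intros simp: J)
    then have "((\<lambda>t::real. h \<bullet> (P *v F (z + t *\<^sub>R h))) has_derivative (\<lambda>t. h \<bullet> (P *v (J *v (t *\<^sub>R h))))) (at 0)"
      by (intro has_derivative_inner_right bounded_linear.has_derivative[OF matrix_vector_mul_bounded_linear])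
    then have "((\<lambda>t::real. h \<bullet> (P *v F (z + t *\<^sub>R h))) has_real_derivative h \<bullet> (P *v (J *v h))) (at 0)"
      by (simp add: has_field_derivative_def matrix_vector_mult_scaleR mult.commute[of _ "h \<bullet> _"])
    then have "((\<lambda>t. h \<bullet> (P *v (F (z + t *\<^sub>R h) - F z)) / t) \<longlongrightarrow> h \<bullet> (P *v (J *v h))) (at 0)"
      by (simp add: DERIV_def matrix_vector_mult_diff_distrib inner_diff_right)
    moreover have "h \<bullet> (P *v (F (z + t *\<^sub>R h) - F z)) / t \<le> - c * (h \<bullet> (P *v h))" if "t \<noteq> 0" for t
    proof -
      define y where "y = h \<bullet> (P *v (F (z + t *\<^sub>R h) - F z))"
      \<comment> \<open>For the increment \<open>t *\<^sub>R h\<close> the left side of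
        \<open>osl\<close> carries a factor \<open>t\<close> and the right side
        \<open>t\<^sup>2\<close>. Writing \<open>t * y\<close> as \<open>t\<^sup>2 * (y / t)\<close>
        permits division whatever the sign of \<open>t\<close>.\<close>
      have "t * y \<le> t\<^sup>2 * (- c * (h \<bullet> (P *v h)))"
        using osl[of "z + t *\<^sub>R h" z]
        by (simp add: y_def matrix_vector_mult_scaleR power2_eq_square mult_ac)
      then have "t\<^sup>2 * (y / t) \<le> t\<^sup>2 * (- c * (h \<bullet> (P *v h)))"
        using that by (simp add: power2_eq_square)
      then show ?thesis using that by (simp only: y_def mult_le_cancel_left) auto
    qed
    then have "\<forall>\<^sub>F t in at 0. h \<bullet> (P *v (F (z + t *\<^sub>R h) - F z)) / t \<le> - c * (h \<bullet> (P *v h))"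
      by (simp add: eventually_at_filter)
    ultimately show "h \<bullet> (P *v (jacobian F (at z) *v h)) \<le> - c * (h \<bullet> (P *v h))"
      unfolding J_def by (rule tendsto_upperbound) simp
  qed
  ultimately show ?thesis
    using assms by (simp add: strongly_infinitesimally_contracting_def)
qed

section \<open>The weight matrix\<close>

text \<open>Both off-diagonal terms are expressed through \<open>transpose C\<close>, so that only
  vectors of the type of \<open>x\<close>, such as \<open>p\<close> and \<open>q\<close>, appear in
  them.\<close>

lemma inner_block_mat_join_vec:
  fixes C :: "real^'n^'m" and x y :: "real^'n" and \<xi> \<eta> :: "real^'m"
  shows "join_vec x \<xi> \<bullet> (block_mat (a *\<^sub>R mat 1) (transpose C) C (b *\<^sub>R mat 1) *v join_vec y \<eta>)
    = a * (x \<bullet> y) + (transpose C *v \<eta>) \<bullet> x + (transpose C *v \<xi>) \<bullet> y + b * (\<xi> \<bullet> \<eta>)"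
proof -
  have "(transpose C *v \<zeta>) \<bullet> w = \<zeta> \<bullet> (C *v w)" for \<zeta> w
    by (metis inner_transpose_mult inner_commute)
  then show ?thesis
    unfolding block_mat_mult_join_vec inner_join_vec proj_left_join_vec proj_right_join_vec
    by (simp add: inner_add_right scaleR_matrix_vector_assoc[symmetric] inner_commute[of x "transpose C *v \<eta>"]
        del: transpose_matrix_vector)
qed

text \<open>A Schur complement argument: multiply the form by \<open>a\<close> and complete the
  square in \<open>x\<close>. The rest is at least
  \<open>(a * b - c) * (norm \<xi>)\<^sup>2\<close>.\<close>

lemma pos_def_block_mat:
  fixes C :: "real^'n^'m"
  assumes "0 < a" and "c < a * b" and C: "C ** transpose C \<preceq>\<^sub>L c *\<^sub>R mat 1"
  shows "pos_def (block_mat (a *\<^sub>R mat 1) (transpose C) C (b *\<^sub>R mat 1))"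
    (is "pos_def ?P")
  unfolding pos_def_def
proof (intro conjI allI impI)
  show "transpose ?P = ?P"
    by (simp add: transpose_block_mat transpose_scalar)
  fix z :: "real^('n + 'm)" assume "z \<noteq> 0"
  define x \<xi> p where "x = proj_left z" and "\<xi> = proj_right z" and "p = transpose C *v \<xi>"
  have z: "z = join_vec x \<xi>" by (simp add: x_def \<xi>_def)
  have "z \<bullet> (?P *v z) = a * (x \<bullet> x) + 2 * (p \<bullet> x) + b * (\<xi> \<bullet> \<xi>)"
    by (simp add: z inner_block_mat_join_vec p_def)
  then have "a * (z \<bullet> (?P *v z)) = (norm (a *\<^sub>R x + p))\<^sup>2 + (a * b * (norm \<xi>)\<^sup>2 - (norm p)\<^sup>2)"
    unfolding power2_norm_eq_inner by (simp add: inner_add inner_commute algebra_simps)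
  moreover have "(norm p)\<^sup>2 \<le> c * (norm \<xi>)\<^sup>2"
    unfolding p_def by (rule norm_transpose_mult_le[OF C])
  ultimately have le: "(norm (a *\<^sub>R x + p))\<^sup>2 + (a * b - c) * (norm \<xi>)\<^sup>2 \<le> a * (z \<bullet> (?P *v z))"
    by (simp add: algebra_simps)
  have "0 < (norm (a *\<^sub>R x + p))\<^sup>2 + (a * b - c) * (norm \<xi>)\<^sup>2"
  proof (cases "\<xi> = 0")
    case True
    have "join_vec (0 :: real^'n) (0 :: real^'m) = 0"
      by (simp add: join_vec_def vec_eq_iff split: sum.split)
    with True have "x \<noteq> 0" using \<open>z \<noteq> 0\<close> z by metis
    then show ?thesis using True \<open>0 < a\<close> by (simp add: p_def)
  next
    case False
    then show ?thesis using assms(2) by (intro add_nonneg_pos mult_pos_pos) simp_all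
  qed
  with le have "0 < a * (z \<bullet> (?P *v z))" by linarith
  then show "0 < z \<bullet> (?P *v z)" using \<open>0 < a\<close> by (simp add: zero_less_mult_iff)
qed

section \<open>The SPPI field\<close>

text \<open>Supplies the local Lipschitz condition in the definition of contraction; the field is
  composed of linear maps, ReLU and the Lipschitz gradient.\<close>

lemma SPPI_field_lipschitz:
  fixes f :: "real^'n \<Rightarrow> real" and C :: "real^'n^'m"
  assumes "smooth_fun L f"
  obtains K where "K-lipschitz_on UNIV (SPPI_field f C d k\<^sub>p k\<^sub>i)"
proof -
  have lin: "\<exists>K. K-lipschitz_on UNIV g" if "linear g"
    for g :: "'b::euclidean_space \<Rightarrow> 'c::euclidean_space"
  proof -
    have g: "bounded_linear g" using that by (simp add: linear_conv_bounded_linear)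
    then obtain K where "0 < K" "\<And>x. norm (g x) \<le> norm x * K"
      using bounded_linear.pos_bounded by blast
    then have "K-lipschitz_on UNIV g"
      by (intro lipschitz_onI) (simp_all add: dist_norm linear_diff[OF that, symmetric] mult.commute)
    then show ?thesis ..
  qed
  obtain K1 where 1: "K1-lipschitz_on UNIV (proj_left :: real^('n + 'm) \<Rightarrow> real^'n)"
    using lin[OF linear_proj_left] by blast
  obtain K2 where 2: "K2-lipschitz_on UNIV (proj_right :: real^('n + 'm) \<Rightarrow> real^'m)"
    using lin[OF linear_proj_right] by blast
  obtain K3 where 3: "K3-lipschitz_on UNIV ((*v) C)"
    using lin[OF matrix_vector_mul_linear] by blast
  obtain K4 where 4: "K4-lipschitz_on UNIV ((*v) (transpose C))"
    using lin[OF matrix_vector_mul_linear] by blast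
  obtain K5 where 5: "K5-lipschitz_on UNIV (\<lambda>p. join_vec (fst p) (snd p) :: real^('n + 'm))"
    using lin[OF linear_join_vec] by blast
  have g: "L-lipschitz_on UNIV (gradient f)"
    using assms by (simp add: smooth_fun_def)
  have relu: "1-lipschitz_on UNIV (relu :: real^'m \<Rightarrow> real^'m)"
    by (rule lipschitz_onI) (simp_all add: dist_norm norm_relu_diff_le)
  have comp: "(D * C)-lipschitz_on UNIV (\<lambda>x. g (h x))"
    if "C-lipschitz_on UNIV h" "D-lipschitz_on UNIV g"
    for C D :: real and g :: "'b::metric_space \<Rightarrow> 'c::metric_space" and h :: "'d::metric_space \<Rightarrow> 'b"
    using that by (intro lipschitz_on_compose2) (auto intro: lipschitz_on_subset)
  define u where "u = (\<lambda>z :: real^('n + 'm). relu (proj_right z + k\<^sub>p *\<^sub>R (C *v proj_left z - d)))"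
  obtain K6 where 6: "K6-lipschitz_on UNIV u"
    using comp[OF lipschitz_on_add[OF 2 lipschitz_on_cmult[OF
          lipschitz_on_diff[OF comp[OF 1 3] lipschitz_on_constant]]] relu]
    unfolding u_def by blast
  \<comment> \<open>The \<open>fst\<close>/\<open>snd\<close> form presents \<open>join_vec\<close>
    as a linear map of a single argument, which matches fact 5.\<close>
  have F: "SPPI_field f C d k\<^sub>p k\<^sub>i = (\<lambda>z. join_vec
      (fst (- gradient f (proj_left z) - transpose C *v u z, k\<^sub>i *\<^sub>R u z - k\<^sub>i *\<^sub>R proj_right z))
      (snd (- gradient f (proj_left z) - transpose C *v u z, k\<^sub>i *\<^sub>R u z - k\<^sub>i *\<^sub>R proj_right z)))"
    by (simp add: SPPI_field_def u_def Let_def fun_eq_iff)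
  note J = comp[OF lipschitz_on_Pair[OF
          lipschitz_on_diff[OF lipschitz_on_minus[OF comp[OF 1 g]] comp[OF 6 4]]
          lipschitz_on_diff[OF lipschitz_on_cmult[OF 6, of k\<^sub>i] lipschitz_on_cmult[OF 2, of k\<^sub>i]]] 5]
  show ?thesis
    by (rule that, unfold F, rule J)
qed

text \<open>The constants enter only through the inequalities they must satisfy, which keeps their
  closed formulas out of the estimate.\<close>

lemma SPPI_field_one_sided_lipschitz:
  fixes f :: "real^'n \<Rightarrow> real" and C :: "real^'n^'m" and d :: "real^'m"
  assumes sc: "strongly_convex \<rho> f" and sm: "smooth_fun L f" and pos: "0 < \<rho>" "0 < L" "0 < k\<^sub>p" "0 < k\<^sub>i"
    and Cmin: "c\<^sub>m\<^sub>i\<^sub>n *\<^sub>R mat 1 \<preceq>\<^sub>L C ** transpose C"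
    and Cmax: "C ** transpose C \<preceq>\<^sub>L c\<^sub>m\<^sub>a\<^sub>x *\<^sub>R mat 1"
    and c\<gamma>: "c * \<gamma> = 3 * k\<^sub>i * k\<^sub>p * c\<^sub>m\<^sub>i\<^sub>n / 8" and "0 \<le> c\<^sub>m\<^sub>i\<^sub>n" and "0 \<le> X" and "0 \<le> \<gamma>"
    and \<gamma>max: "k\<^sub>p * c\<^sub>m\<^sub>a\<^sub>x \<le> \<gamma>"
    and \<gamma>: "2 / 3 * L + c * \<gamma> / \<rho> + 2 / 3 * (X * (X + 2 * L) / \<rho>) \<le> \<gamma>"
    and X: "\<bar>k\<^sub>i / 2 - 2 * c\<bar> \<le> X" "(k\<^sub>i / 2 - 2 * c)\<^sup>2 + 3 / 8 * k\<^sub>i\<^sup>2 \<le> X\<^sup>2"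
  defines "P \<equiv> block_mat (\<gamma> *\<^sub>R mat 1) (transpose C) C ((\<gamma> / (k\<^sub>i * k\<^sub>p)) *\<^sub>R mat 1)"
    and "F \<equiv> SPPI_field f C d k\<^sub>p k\<^sub>i"
  shows "(w - z) \<bullet> (P *v (F w - F z)) \<le> - c * ((w - z) \<bullet> (P *v (w - z)))"
proof -
  define x where "x = proj_left w - proj_left z"
  define \<xi> where "\<xi> = proj_right w - proj_right z"
  define g where "g = gradient f (proj_left w) - gradient f (proj_left z)"
  define y where "y = (\<lambda>z :: real^('n + 'm). proj_right z + k\<^sub>p *\<^sub>R (C *v proj_left z - d))"
  define u where "u = relu (y w) - relu (y z)"
  define v where "v = \<xi> - u"
  define p where "p = transpose C *v \<xi>"
  define q where "q = transpose C *v v"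
  have wz: "w - z = join_vec x \<xi>"
    by (auto simp: x_def \<xi>_def join_vec_def proj_left_def proj_right_def vec_eq_iff split: sum.split)
  have tu: "transpose C *v u = p - q"
    by (simp add: p_def q_def v_def matrix_vector_mult_diff_distrib del: transpose_matrix_vector)
  have "F w - F z = join_vec (- g - transpose C *v u) (- (k\<^sub>i *\<^sub>R v))"
    by (auto simp: F_def SPPI_field_def Let_def g_def u_def v_def \<xi>_def y_def join_vec_def vec_eq_iff
        matrix_vector_mult_diff_distrib algebra_simps simp del: transpose_matrix_vector split: sum.split)
  then have Fwz: "F w - F z = join_vec (- g - (p - q)) (- (k\<^sub>i *\<^sub>R v))"
    unfolding tu .
  have "transpose C *v (- (k\<^sub>i *\<^sub>R v)) = - (k\<^sub>i *\<^sub>R q)"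
    unfolding q_def scaleR_minus_left[symmetric] matrix_vector_mult_scaleR ..
  then have lhs: "(w - z) \<bullet> (P *v (F w - F z))
      = - \<gamma> * (x \<bullet> g) - \<gamma> * (x \<bullet> (p - q)) - k\<^sub>i * (x \<bullet> q) - p \<bullet> g - (norm p)\<^sup>2 + p \<bullet> q - \<gamma> / k\<^sub>p * (\<xi> \<bullet> v)"
    using pos unfolding P_def wz Fwz inner_block_mat_join_vec p_def[symmetric] power2_norm_eq_inner
    by (simp add: inner_diff_right inner_commute[of q x] right_diff_distrib)
  have rhs: "(w - z) \<bullet> (P *v (w - z)) = \<gamma> * (norm x)\<^sup>2 + 2 * (x \<bullet> p) + \<gamma> / (k\<^sub>i * k\<^sub>p) * (norm \<xi>)\<^sup>2"
    unfolding P_def wz inner_block_mat_join_vec p_def[symmetric] power2_norm_eq_inner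
    by (simp add: inner_commute[of p x])
  have "(norm u)\<^sup>2 \<le> (y w - y z) \<bullet> u"
    unfolding u_def by (rule relu_firmly_nonexpansive)
  also have "y w - y z = \<xi> + k\<^sub>p *\<^sub>R (C *v x)"
    by (simp add: y_def \<xi>_def x_def matrix_vector_mult_diff_distrib algebra_simps)
  finally have "(norm u)\<^sup>2 \<le> \<xi> \<bullet> u + k\<^sub>p * (x \<bullet> (p - q))"
    by (simp add: tu[symmetric] inner_transpose_mult inner_add_left del: transpose_matrix_vector)
  moreover have "(norm u)\<^sup>2 - \<xi> \<bullet> u = (norm v)\<^sup>2 - \<xi> \<bullet> v"
    unfolding v_def power2_norm_eq_inner by (simp add: inner_diff inner_commute)
  ultimately have "(norm v)\<^sup>2 \<le> \<xi> \<bullet> v + k\<^sub>p * (x \<bullet> (p - q))"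
    by linarith
  \<comment> \<open>Scaled by \<open>\<gamma> / k\<^sub>p\<close>, the ReLU inequality absorbs
    exactly the terms \<open>- \<gamma> * (x \<bullet> (p - q))\<close> and
    \<open>- \<gamma> / k\<^sub>p * (\<xi> \<bullet> v)\<close> of \<open>lhs\<close>. The bound on
    \<open>\<gamma>\<close> then turns the gain into \<open>(norm q)\<^sup>2\<close>.\<close>
  then have "\<gamma> / k\<^sub>p * (norm v)\<^sup>2 \<le> \<gamma> / k\<^sub>p * (\<xi> \<bullet> v + k\<^sub>p * (x \<bullet> (p - q)))"
    using pos \<open>0 \<le> \<gamma>\<close> by (intro mult_left_mono) simp_all
  moreover have "c\<^sub>m\<^sub>a\<^sub>x * (norm v)\<^sup>2 \<le> \<gamma> / k\<^sub>p * (norm v)\<^sup>2"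
    using \<gamma>max pos by (intro mult_right_mono) (simp_all add: le_divide_eq mult.commute)
  moreover have "(norm q)\<^sup>2 \<le> c\<^sub>m\<^sub>a\<^sub>x * (norm v)\<^sup>2"
    unfolding q_def by (rule norm_transpose_mult_le[OF Cmax])
  moreover have "\<gamma> / k\<^sub>p * (\<xi> \<bullet> v + k\<^sub>p * (x \<bullet> (p - q))) = \<gamma> / k\<^sub>p * (\<xi> \<bullet> v) + \<gamma> * (x \<bullet> (p - q))"
    using pos by (simp add: distrib_left)
  moreover have "c * \<gamma> * (norm x)\<^sup>2 + 2 * c * (x \<bullet> p) + 3 / 8 * (norm p)\<^sup>2
      \<le> \<gamma> * (x \<bullet> g) + (norm q)\<^sup>2 + p \<bullet> g + (norm p)\<^sup>2 - p \<bullet> q + k\<^sub>i * (x \<bullet> q)"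
  proof (rule contraction_form_nonneg[OF pos(1) _ _ _ _ \<gamma> _ \<open>0 \<le> X\<close> X])
    show "\<rho> * (norm x)\<^sup>2 \<le> x \<bullet> g"
      unfolding x_def g_def by (rule gradient_strongly_monotone[OF sc sm])
    show "(norm g)\<^sup>2 \<le> L * (x \<bullet> g)"
      unfolding x_def g_def by (rule gradient_cocoercive[OF sc _ sm]) (use pos in simp_all)
    show "norm g \<le> L * norm x"
      unfolding x_def g_def by (rule smooth_fun_norm_le[OF sm])
    show "0 \<le> c * \<gamma>" using pos \<open>0 \<le> c\<^sub>m\<^sub>i\<^sub>n\<close> by (simp add: c\<gamma>)
  qed (use pos in simp)
  moreover have "c\<^sub>m\<^sub>i\<^sub>n * (norm \<xi>)\<^sup>2 \<le> (norm p)\<^sup>2"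
    unfolding p_def by (rule norm_transpose_mult_ge[OF Cmin])
  \<comment> \<open>The rate is chosen so that the \<open>\<xi>\<close> block of the weight costs
    \<open>3 / 8 * c\<^sub>m\<^sub>i\<^sub>n\<close>, which the reserved
    \<open>3 / 8 * (norm p)\<^sup>2\<close> pays for.\<close>
  moreover have "c * (\<gamma> * (norm x)\<^sup>2 + 2 * (x \<bullet> p) + \<gamma> / (k\<^sub>i * k\<^sub>p) * (norm \<xi>)\<^sup>2)
      = c * \<gamma> * (norm x)\<^sup>2 + 2 * c * (x \<bullet> p) + 3 / 8 * (c\<^sub>m\<^sub>i\<^sub>n * (norm \<xi>)\<^sup>2)"
  proof -
    have "c * (\<gamma> / (k\<^sub>i * k\<^sub>p)) = 3 / 8 * c\<^sub>m\<^sub>i\<^sub>n"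
      using pos c\<gamma> by (simp add: field_simps)
    then have "c * (\<gamma> / (k\<^sub>i * k\<^sub>p) * (norm \<xi>)\<^sup>2) = 3 / 8 * (c\<^sub>m\<^sub>i\<^sub>n * (norm \<xi>)\<^sup>2)"
      by (simp only: mult.assoc[symmetric])
    then show ?thesis by (simp only: distrib_left mult.assoc mult.left_commute[of c 2])
  qed
  ultimately show ?thesis
    unfolding lhs rhs by linarith
qed

section \<open>Checking the constants\<close>

theorem theorem5p1:
  fixes f :: "real^'n \<Rightarrow> real" and C :: "real^'n^'m" and d :: "real^'m"
    and \<rho> L c\<^sub>m\<^sub>i\<^sub>n c\<^sub>m\<^sub>a\<^sub>x k\<^sub>p k\<^sub>i \<epsilon> \<gamma> X c\<^sub>i\<^sub>n :: real
    and P :: "real^('n + 'm)^('n + 'm)"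
  assumes "0 < \<rho>" and "0 < L"
    and "strongly_convex \<rho> f" and "smooth_fun L f"
    and "0 < c\<^sub>m\<^sub>i\<^sub>n" and "0 < c\<^sub>m\<^sub>a\<^sub>x"
    and "c\<^sub>m\<^sub>i\<^sub>n *\<^sub>R mat 1 \<preceq>\<^sub>L C ** transpose C"
    and "C ** transpose C \<preceq>\<^sub>L c\<^sub>m\<^sub>a\<^sub>x *\<^sub>R mat 1"
    and "0 < k\<^sub>p" and "0 < k\<^sub>i" and "0 < \<epsilon>"
    and "X = k\<^sub>p * c\<^sub>m\<^sub>a\<^sub>x + 3 * k\<^sub>i * c\<^sub>m\<^sub>i\<^sub>n / (4 * c\<^sub>m\<^sub>a\<^sub>x) + k\<^sub>i * sqrt (c\<^sub>m\<^sub>a\<^sub>x / c\<^sub>m\<^sub>i\<^sub>n)"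
    and "\<gamma> = Max {k\<^sub>i, k\<^sub>p * c\<^sub>m\<^sub>a\<^sub>x,
               2 / 3 * L + 3 * k\<^sub>i * k\<^sub>p * c\<^sub>m\<^sub>i\<^sub>n / (8 * \<rho>) + 2 / 3 * (X * (X + 2 * L) / \<rho>)} + \<epsilon>"
    and "c\<^sub>i\<^sub>n = 3 * k\<^sub>i * k\<^sub>p * c\<^sub>m\<^sub>i\<^sub>n / (8 * \<gamma>)"
    and "P = block_mat (\<gamma> *\<^sub>R mat 1) (transpose C) C ((\<gamma> / (k\<^sub>i * k\<^sub>p)) *\<^sub>R mat 1)"
  shows "pos_def P \<and>
    strongly_infinitesimally_contracting c\<^sub>i\<^sub>n P (SPPI_field f C d k\<^sub>p k\<^sub>i)"
proof -
  note pos = assms(1,2,5,6,9-11)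
  have \<gamma>i: "k\<^sub>i < \<gamma>" and \<gamma>max: "k\<^sub>p * c\<^sub>m\<^sub>a\<^sub>x < \<gamma>"
    and \<gamma>: "2 / 3 * L + 3 * k\<^sub>i * k\<^sub>p * c\<^sub>m\<^sub>i\<^sub>n / (8 * \<rho>) + 2 / 3 * (X * (X + 2 * L) / \<rho>) < \<gamma>"
    using \<open>0 < \<epsilon>\<close> unfolding assms(13) by (simp_all add: max_def)
  have "0 < \<gamma>" using \<gamma>i pos by linarith
  have min_max: "c\<^sub>m\<^sub>i\<^sub>n \<le> c\<^sub>m\<^sub>a\<^sub>x"
  proof -
    \<comment> \<open>Any unit vector will do: both Loewner bounds on
      \<open>C ** transpose C\<close> are compared at it.\<close>
    define e :: "real^'m" where "e = axis undefined 1"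
    have "norm e = 1" by (simp add: e_def)
    then show ?thesis
      using norm_transpose_mult_ge[OF assms(7), of e] norm_transpose_mult_le[OF assms(8), of e] by simp
  qed
  have c\<gamma>: "c\<^sub>i\<^sub>n * \<gamma> = 3 * k\<^sub>i * k\<^sub>p * c\<^sub>m\<^sub>i\<^sub>n / 8"
    using \<open>0 < \<gamma>\<close> by (simp add: assms(14))
  have "0 < c\<^sub>i\<^sub>n" using pos \<open>0 < \<gamma>\<close> by (simp add: assms(14))
  have "c\<^sub>i\<^sub>n \<le> 3 / 8 * k\<^sub>i"
  proof -
    have "k\<^sub>p * c\<^sub>m\<^sub>i\<^sub>n \<le> \<gamma>"
      using min_max \<gamma>max pos by (smt (verit) mult_left_mono)
    then have "3 / 8 * k\<^sub>i * (k\<^sub>p * c\<^sub>m\<^sub>i\<^sub>n) \<le> 3 / 8 * k\<^sub>i * \<gamma>"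
      using pos by (intro mult_left_mono) simp_all
    then have "c\<^sub>i\<^sub>n * \<gamma> \<le> 3 / 8 * k\<^sub>i * \<gamma>" by (simp add: c\<gamma>)
    then show ?thesis using \<open>0 < \<gamma>\<close> by simp
  qed
  \<comment> \<open>Here \<open>2 * c\<^sub>i\<^sub>n\<close> lies between 0 and
    \<open>3 / 4 * k\<^sub>i\<close>.\<close>
  then have s: "\<bar>k\<^sub>i / 2 - 2 * c\<^sub>i\<^sub>n\<bar> \<le> k\<^sub>i / 2"
    using \<open>0 < c\<^sub>i\<^sub>n\<close> pos by linarith
  \<comment> \<open>The root is at least 1 because
    \<open>c\<^sub>m\<^sub>i\<^sub>n \<le> c\<^sub>m\<^sub>a\<^sub>x\<close>; this yields
    \<open>k\<^sub>i \<le> X\<close>.\<close>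
  have "k\<^sub>i * 1 \<le> k\<^sub>i * sqrt (c\<^sub>m\<^sub>a\<^sub>x / c\<^sub>m\<^sub>i\<^sub>n)"
    using min_max pos by (intro mult_left_mono) simp_all
  moreover have "0 \<le> k\<^sub>p * c\<^sub>m\<^sub>a\<^sub>x + 3 * k\<^sub>i * c\<^sub>m\<^sub>i\<^sub>n / (4 * c\<^sub>m\<^sub>a\<^sub>x)"
    using pos by simp
  ultimately have X: "k\<^sub>i \<le> X" unfolding assms(12) by linarith
  have osl: "(w - z) \<bullet> (P *v (SPPI_field f C d k\<^sub>p k\<^sub>i w - SPPI_field f C d k\<^sub>p k\<^sub>i z))
      \<le> - c\<^sub>i\<^sub>n * ((w - z) \<bullet> (P *v (w - z)))" for w z
    unfolding assms(15)
  proof (rule SPPI_field_one_sided_lipschitz[OF assms(3,4,1,2,9,10,7,8) c\<gamma>])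
    show "2 / 3 * L + c\<^sub>i\<^sub>n * \<gamma> / \<rho> + 2 / 3 * (X * (X + 2 * L) / \<rho>) \<le> \<gamma>"
      using \<gamma> by (simp add: c\<gamma>)
    show "\<bar>k\<^sub>i / 2 - 2 * c\<^sub>i\<^sub>n\<bar> \<le> X" using s X pos by linarith
    \<comment> \<open>With the square at most \<open>k\<^sub>i\<^sup>2 / 4\<close>, the sum is at
      most 5/8 of \<open>k\<^sub>i\<^sup>2\<close>, hence below \<open>X\<^sup>2\<close>.\<close>
    have "(k\<^sub>i / 2 - 2 * c\<^sub>i\<^sub>n)\<^sup>2 \<le> (k\<^sub>i / 2)\<^sup>2"
      using s pos by (subst abs_le_square_iff[symmetric]) simp
    moreover have "(k\<^sub>i / 2)\<^sup>2 = k\<^sub>i\<^sup>2 / 4" by (simp add: power_divide)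
    moreover have "k\<^sub>i\<^sup>2 \<le> X\<^sup>2" using X pos by (intro power_mono) simp_all
    moreover have "0 \<le> k\<^sub>i\<^sup>2" by simp
    ultimately show "(k\<^sub>i / 2 - 2 * c\<^sub>i\<^sub>n)\<^sup>2 + 3 / 8 * k\<^sub>i\<^sup>2 \<le> X\<^sup>2" by linarith
  qed (use pos X \<gamma>max \<open>0 < \<gamma>\<close> in simp_all)
  have P: "pos_def P"
    unfolding assms(15)
  proof (rule pos_def_block_mat[OF \<open>0 < \<gamma>\<close> _ assms(8)])
    \<comment> \<open>The margin \<open>\<epsilon>\<close> makes both lower bounds on
      \<open>\<gamma>\<close> strict; their product is the Schur complement condition.\<close>
    have "k\<^sub>i * (k\<^sub>p * c\<^sub>m\<^sub>a\<^sub>x) < \<gamma> * \<gamma>"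
      using \<gamma>i \<gamma>max pos by (intro mult_strict_mono) simp_all
    then show "c\<^sub>m\<^sub>a\<^sub>x < \<gamma> * (\<gamma> / (k\<^sub>i * k\<^sub>p))"
      using pos by (simp add: less_divide_eq mult_ac)
  qed
  obtain K where "K-lipschitz_on UNIV (SPPI_field f C d k\<^sub>p k\<^sub>i)"
    using SPPI_field_lipschitz[OF assms(4)] .
  then show ?thesis
    using strongly_infinitesimally_contractingI[OF \<open>0 < c\<^sub>i\<^sub>n\<close> P _ osl] P by blast
qed

end
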